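(* Let $k\ge2$ and let $\varphi$ be a $k$-SAT formula with $p$ clauses in $q$ variables such that every variable appears in the formula. Then there is a block configuration $\mathcal{B}$ of length $q+p$, of size at most $2q+p(2^k-1)$ and of rank at most $kp$, such that $\mathrm{CTP}(\mathcal{B})$ is an extension of $P(\varphi)$, where the affine map from $\mathrm{CTP}(\mathcal{B})$ onto $P(\varphi)$ is a coordinate projection. In case of $k=2$ the coordinate projection induces an (affine) isomorphism between $\mathrm{CTP}(\mathcal{B})$ and $P(\varphi)$.
   Context: A $k$-SAT formula ($k\in\{2,3,\dots\}$) is a Boolean formula $\varphi=\bigwedge_{i=1}^p C_i$ in $q$ variables, where each clause $C_i$ is a disjunction of $k_i\in[k]=\{1,\dots,k\}$ literals associated with $k_i$ pairwise different variables; a literal is a variable $b$ or its negation $\lnot b$. Here $p,q\ge 1$. Identifying true with $1$ and false with $0$, $\varphi$ induces a function $\{0,1\}^q\to\{0,1\}$; set $T(\varphi)=\{x\in\{0,1\}^q:\varphi(x)=1\}$ and $P(\varphi)=\operatorname{conv}(T(\varphi))\subseteq\mathbb{R}^q$ (possibly empty). A polytope $Q$ is an extension of a polytope $P$ if $P$ is the image of $Q$ under some affine map. $\mathbb{F}_2$ is the field with two elements. A block configuration in $\mathbb{F}_2^d$ ($d\ge1$) is a sequence $\mathcal{B}=(\mathcal{B}(1),\dots,\mathcal{B}(n))$ with $n\ge2$ of non-empty subsets (blocks) $\mathcal{B}(i)\subseteq\mathbb{F}_2^d$; $n$ is its length, $\sum_i|\mathcal{B}(i)|$ its size, and its rank is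 the dimension of the linear span of $\mathcal{B}(1)\cup\dots\cup\mathcal{B}(n)$. A cyclic transversal of $\mathcal{B}$ is a sequence $\xi=(\xi(1),\dots,\xi(n))$ with $\xi(i)\in\mathcal{B}(i)$ and $\sum_{i=1}^n\xi(i)=0$ in $\mathbb{F}_2^d$. Its incidence vector is $x=(x^1,\dots,x^n)$, $x^i\in\{0,1\}^{\mathcal{B}(i)}$, with $x^i_\omega=1$ iff $\xi(i)=\omega$. The cyclic transversal polytope $\mathrm{CTP}(\mathcal{B})\subseteq\mathbb{R}^{\mathcal{B}(1)}\times\cdots\times\mathbb{R}^{\mathcal{B}(n)}$ is the convex hull of the incidence vectors of all cyclic transversals of $\mathcal{B}$ (possibly empty). *)

theory Defs
  imports "HOL-Analysis.Analysis" "HOL-Analysis.Finite_Function_Topology"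
    "HOL-Library.Z2"
begin

section \<open>SAT formulas and their polytopes\<close>

text \<open>
  The \<open>q\<close> variables are the elements of a finite type \<open>'v\<close> (so \<open>q = CARD('v)\<close>), and a formula is
  the sequence of its clauses.
\<close>

datatype 'v literal = Pos 'v | Neg 'v

primrec lit_var :: "'v literal \<Rightarrow> 'v" where
  "lit_var (Pos v) = v"
| "lit_var (Neg v) = v"

primrec lit_holds :: "('v \<Rightarrow> bool) \<Rightarrow> 'v literal \<Rightarrow> bool" where
  "lit_holds a (Pos v) \<longleftrightarrow> a v"
| "lit_holds a (Neg v) \<longleftrightarrow> \<not> a v"

type_synonym 'v clause = "'v literal list"
type_synonym 'v formula = "'v clause list"

definition ksat_formula :: "nat \<Rightarrow> 'v formula \<Rightarrow> bool" where
  "ksat_formula k \<phi> \<longleftrightarrow> \<phi> \<noteq> [] \<and>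
     (\<forall>C \<in> set \<phi>. 1 \<le> length C \<and> length C \<le> k \<and> distinct (map lit_var C))"

definition formula_vars :: "'v formula \<Rightarrow> 'v set" where
  "formula_vars \<phi> = (\<Union>C \<in> set \<phi>. lit_var ` set C)"

definition formula_holds :: "('v \<Rightarrow> bool) \<Rightarrow> 'v formula \<Rightarrow> bool" where
  "formula_holds a \<phi> \<longleftrightarrow> (\<forall>C \<in> set \<phi>. \<exists>l \<in> set C. lit_holds a l)"

definition true_points :: "'v::finite formula \<Rightarrow> (real ^ 'v) set" where
  "true_points \<phi> = {(\<chi> v. of_bool (a v)) | a. formula_holds a \<phi>}"

definition sat_polytope :: "'v::finite formula \<Rightarrow> (real ^ 'v) set" where
  "sat_polytope \<phi> = convex hull (true_points \<phi>)"


section \<open>Extensions and affine isomorphisms\<close>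

definition affine_map :: "('a::real_vector \<Rightarrow> 'b::real_vector) \<Rightarrow> bool" where
  "affine_map f \<longleftrightarrow> (\<exists>h c. linear h \<and> f = (\<lambda>x. h x + c))"

definition extension_via ::
  "('a::real_vector \<Rightarrow> 'b::real_vector) \<Rightarrow> 'a set \<Rightarrow> 'b set \<Rightarrow> bool" where
  "extension_via f Q P \<longleftrightarrow> polytope Q \<and> polytope P \<and> affine_map f \<and> f ` Q = P"

text \<open>
  The inverse bijection is also required to be induced by an affine map of the ambient spaces.
\<close>

definition affine_isomorphism ::
  "('a::real_vector \<Rightarrow> 'b::real_vector) \<Rightarrow> 'a set \<Rightarrow> 'b set \<Rightarrow> bool" where
  "affine_isomorphism f Q P \<longleftrightarrow> affine_map f \<and> bij_betw f Q P \<and>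
     (\<exists>g. affine_map g \<and> (\<forall>x \<in> Q. g (f x) = x))"

text \<open>
  For a finite index set \<open>I\<close>, the space of real vectors with coordinates in \<open>I\<close> is regarded as the set
  of finitely supported functions that vanish outside \<open>I\<close>. A coordinate projection selects pairwise
  different coordinates in \<open>I\<close>, one for each coordinate \<open>v\<close> of the target space.
\<close>

definition coordinate_projection ::
  "'i set \<Rightarrow> (('i \<Rightarrow>\<^sub>0 real) \<Rightarrow> real ^ 'v::finite) \<Rightarrow> bool" where
  "coordinate_projection I \<pi> \<longleftrightarrow>
     (\<exists>\<sigma>. inj \<sigma> \<and> range \<sigma> \<subseteq> I \<and> \<pi> = (\<lambda>x. \<chi> v. Poly_Mapping.lookup x (\<sigma> v)))"


section \<open>Block configurations and cyclic transversal polytopes\<close>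

text \<open>
  The dimension \<open>d\<close> is existentially quantified in the theorem, so the \<open>d\<close>-dimensional coordinate space
  over the two-element field is a set inside one type rather than a type of its own.
\<close>

type_synonym f2vec = "nat \<Rightarrow>\<^sub>0 bit"

definition f2_space :: "nat \<Rightarrow> f2vec set" where
  "f2_space d = {v. Poly_Mapping.keys v \<subseteq> {..<d}}"

definition f2_scale :: "bit \<Rightarrow> f2vec \<Rightarrow> f2vec" where
  "f2_scale c v = Poly_Mapping.map ((*) c) v"

lemma lookup_f2_scale: "Poly_Mapping.lookup (f2_scale c v) j = c * Poly_Mapping.lookup v j"
  unfolding f2_scale_def by (cases c; cases "Poly_Mapping.lookup v j") (simp_all add: Poly_Mapping.map.rep_eq when_def)

interpretation f2: vector_space f2_scale
proof
  fix a b :: bit and x y :: f2vec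
  show "f2_scale a (x + y) = f2_scale a x + f2_scale a y"
    by (rule poly_mapping_eqI) (simp only: lookup_f2_scale lookup_add distrib_left)
  show "f2_scale (a + b) x = f2_scale a x + f2_scale b x"
    by (rule poly_mapping_eqI) (simp only: lookup_f2_scale lookup_add distrib_right)
  show "f2_scale a (f2_scale b x) = f2_scale (a * b) x"
    by (rule poly_mapping_eqI) (simp only: lookup_f2_scale mult.assoc)
  show "f2_scale 1 x = x"
    by (rule poly_mapping_eqI) (simp only: lookup_f2_scale mult_1_left)
qed

text \<open>Blocks are indexed from \<open>0\<close>.\<close>

type_synonym block_config = "f2vec set list"

definition block_configuration :: "nat \<Rightarrow> block_config \<Rightarrow> bool" where
  "block_configuration d \<B> \<longleftrightarrow> 1 \<le> d \<and> 2 \<le> length \<B> \<and>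
     (\<forall>X \<in> set \<B>. X \<noteq> {} \<and> X \<subseteq> f2_space d)"

definition config_size :: "block_config \<Rightarrow> nat" where
  "config_size \<B> = (\<Sum>i<length \<B>. card (\<B> ! i))"

definition config_rank :: "block_config \<Rightarrow> nat" where
  "config_rank \<B> = f2.dim (f2.span (\<Union>i<length \<B>. \<B> ! i))"

definition cyclic_transversals :: "block_config \<Rightarrow> f2vec list set" where
  "cyclic_transversals \<B> = {\<xi>. length \<xi> = length \<B> \<and>
     (\<forall>i<length \<B>. \<xi> ! i \<in> \<B> ! i) \<and> (\<Sum>i<length \<B>. \<xi> ! i) = 0}"

definition config_coords :: "block_config \<Rightarrow> (nat \<times> f2vec) set" where
  "config_coords \<B> = {(i, \<omega>). i < length \<B> \<and> \<omega> \<in> \<B> ! i}"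

definition incidence_vector :: "f2vec list \<Rightarrow> (nat \<times> f2vec) \<Rightarrow>\<^sub>0 real" where
  "incidence_vector \<xi> = (\<Sum>i<length \<xi>. Poly_Mapping.single (i, \<xi> ! i) 1)"

lemma lookup_incidence_vector:
  "Poly_Mapping.lookup (incidence_vector \<xi>) (i, \<omega>) = (if i < length \<xi> \<and> \<xi> ! i = \<omega> then 1 else 0)"
proof -
  have "Poly_Mapping.lookup (incidence_vector \<xi>) (i, \<omega>)
      = (\<Sum>j<length \<xi>. if j = i then (if \<xi> ! i = \<omega> then 1 else 0) else 0)"
    unfolding incidence_vector_def lookup_sum
    by (intro sum.cong) (auto simp: lookup_single when_def)
  then show ?thesis by simp
qed

definition CTP :: "block_config \<Rightarrow> ((nat \<times> f2vec) \<Rightarrow>\<^sub>0 real) set" where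
  "CTP \<B> = convex hull (incidence_vector ` cyclic_transversals \<B>)"

end

theory Submission
  imports Defs
begin

text \<open>
  Let \<open>p\<close> be the number of clauses. Reserve one coordinate of \<open>\<bbbF>\<^sub>2\<^sup>k\<^sup>p\<close>
  for every occurrence of a literal in the formula: the \<open>j\<close>-th literal of clause \<open>i\<close> gets the unit
  vector with index \<open>k * i + j\<close>. For an assignment \<open>a\<close>, the trace of \<open>a\<close> in clause \<open>i\<close> is the sum of
  the unit vectors of those positions of the clause whose variable is true under \<open>a\<close>; it records
  exactly the values of \<open>a\<close> on the variables of the clause. The configuration has

  \<^item> for every variable \<open>v\<close> the block consisting of \<open>0\<close> and the sum of the unit vectors of all
    occurrences of \<open>v\<close>, a choice between false and true;

  \<^item> for every clause the block of the traces of all assignments that satisfy the clause. Out of the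
    at most \<open>2\<^sup>k\<close> conceivable traces it misses the one that makes every literal false.

  Choosing from the variable blocks means choosing an assignment \<open>a\<close>, and the chosen vectors add up to
  the sum of the traces of \<open>a\<close> over all clauses. Different clauses use disjoint sets of coordinates and
  the characteristic is two, so the whole transversal sums to zero if and only if each clause block
  contributes precisely the trace of \<open>a\<close>. That trace lies in the block if and only if \<open>a\<close> satisfies the
  clause. Hence cyclic transversals correspond to satisfying assignments
  (\<open>cyclic_transversals_config\<close>). The coordinate that belongs to the nonzero element of the block of
  \<open>v\<close> reads off the value of \<open>v\<close>, so projecting to these coordinates maps vertices to vertices and,
  being linear, maps the hull onto the hull.

  For \<open>k = 2\<close> the projection can be inverted by an affine map. A clause with two literals has three
  satisfying patterns, which are affinely independent points of the plane, so the indicator of each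
  of them is an affine function of the variables (\<open>affine_clause_indicator\<close>). Consequently each
  coordinate of an incidence vector is an affine function of the assignment.
\<close>

section \<open>Real vectors with finite support and affine maps\<close>

lemma lookup_scaleR:
  "Poly_Mapping.lookup (r *\<^sub>R x) i = r *\<^sub>R Poly_Mapping.lookup (x :: 'i \<Rightarrow>\<^sub>0 real) i"
proof -
  have "finite {i. r *\<^sub>R Poly_Mapping.lookup x i \<noteq> 0}"
    by (rule finite_subset[OF _ finite_lookup[of x]]) auto
  then show ?thesis
    by (simp add: scaleR_poly_mapping_def Abs_poly_mapping_inverse)
qed

lemma affine_map_linear: "linear h \<Longrightarrow> affine_map h"
  unfolding affine_map_def by (intro exI[of _ h] exI[of _ 0]) auto

lemma affine_map_const: "affine_map (\<lambda>x. c)"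
  unfolding affine_map_def
  by (intro exI[of _ "\<lambda>x. 0"] exI[of _ c]) (auto simp: linear_zero)

lemma affine_map_add:
  assumes "affine_map f" "affine_map g"
  shows "affine_map (\<lambda>x. f x + g x)"
proof -
  obtain h c h' c' where "linear h" "f = (\<lambda>x. h x + c)" "linear h'" "g = (\<lambda>x. h' x + c')"
    using assms unfolding affine_map_def by blast
  then show ?thesis
    unfolding affine_map_def
    by (intro exI[of _ "\<lambda>x. h x + h' x"] exI[of _ "c + c'"])
      (auto simp: linear_compose_add algebra_simps)
qed

lemma affine_map_compose_linear:
  assumes "linear L" "affine_map f"
  shows "affine_map (\<lambda>x. L (f x))"
proof -
  obtain h c where "linear h" "f = (\<lambda>x. h x + c)"
    using assms unfolding affine_map_def by blast
  then show ?thesis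
    using assms(1) linear_compose[of h L] unfolding affine_map_def
    by (intro exI[of _ "\<lambda>x. L (h x)"] exI[of _ "L c"]) (auto simp: linear_add o_def)
qed

lemma affine_map_diff:
  assumes "affine_map f" "affine_map g"
  shows "affine_map (\<lambda>x. f x - g x)"
  using affine_map_add[OF assms(1) affine_map_compose_linear[OF _ assms(2), of uminus]]
  by (simp add: linear_uminus)

lemma affine_map_sum:
  "(\<And>i. i \<in> A \<Longrightarrow> affine_map (f i)) \<Longrightarrow> affine_map (\<lambda>x. \<Sum>i\<in>A. f i x)"
  by (induction A rule: infinite_finite_induct) (auto intro: affine_map_const affine_map_add)

lemma affine_map_comb:
  assumes "affine_map f"
  shows "f ((1 - u) *\<^sub>R x + u *\<^sub>R y) = (1 - u) *\<^sub>R f x + u *\<^sub>R f y"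
proof -
  obtain h c where "linear h" "f = (\<lambda>x. h x + c)"
    using assms unfolding affine_map_def by blast
  then show ?thesis
    by (simp add: linear_add linear_diff linear_scale algebra_simps)
qed

text \<open>
  The points at which two affine maps compose to the identity form a convex set, so a left inverse
  has to be checked on the generators only.
\<close>

lemma left_inverse_on_convex_hull:
  assumes f: "affine_map f" and g: "affine_map g"
    and inv: "\<And>x. x \<in> S \<Longrightarrow> g (f x) = x" and x: "x \<in> convex hull S"
  shows "g (f x) = x"
proof -
  have "convex {x. g (f x) = x}"
    by (auto simp: convex_alt affine_map_comb[OF f] affine_map_comb[OF g])
  then have "convex hull S \<subseteq> {x. g (f x) = x}"
    by (intro hull_minimal) (auto simp: inv)
  with x show ?thesis by blast
qed

lemma linear_coordinate_projection:
  "linear (\<lambda>x :: 'i \<Rightarrow>\<^sub>0 real. \<chi> v :: 'v::finite. Poly_Mapping.lookup x (\<sigma> v))"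
  by (rule linearI) (simp_all add: vec_eq_iff lookup_add lookup_scaleR)

section \<open>Vectors over the two-element field\<close>

lemma f2vec_add_self: "(x :: f2vec) + x = 0"
proof (rule poly_mapping_eqI)
  fix m
  have "b + b = 0" for b :: bit by (cases b) auto
  then show "Poly_Mapping.lookup (x + x) m = Poly_Mapping.lookup 0 m"
    by (simp only: lookup_add lookup_zero)
qed

lemma f2_space_add: "x \<in> f2_space d \<Longrightarrow> y \<in> f2_space d \<Longrightarrow> x + y \<in> f2_space d"
  unfolding f2_space_def using keys_add[of x y] by blast

lemma f2_space_zero: "0 \<in> f2_space d"
  unfolding f2_space_def by simp

lemma f2_space_sum: "(\<And>i. i \<in> A \<Longrightarrow> f i \<in> f2_space d) \<Longrightarrow> sum f A \<in> f2_space d"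
  by (induction A rule: infinite_finite_induct) (auto intro: f2_space_add f2_space_zero)

text \<open>The bound comes from the \<open>d\<close> unit vectors, which span \<open>f2_space d\<close>.\<close>

lemma f2_dim_le:
  assumes "X \<subseteq> f2_space d"
  shows "f2.dim X \<le> d"
proof -
  let ?E = "(\<lambda>i. Poly_Mapping.single i (1 :: bit)) ` {..<d}"
  have "v \<in> f2.span ?E" if "v \<in> f2_space d" for v
  proof -
    have "v = (\<Sum>i<d. f2_scale (Poly_Mapping.lookup v i) (Poly_Mapping.single i 1))"
      (is "_ = ?s")
    proof (rule poly_mapping_eqI)
      fix m
      have "Poly_Mapping.lookup ?s m = (\<Sum>i<d. if i = m then Poly_Mapping.lookup v i else 0)"
        unfolding lookup_sum by (intro sum.cong) (auto simp: lookup_f2_scale lookup_single when_def)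
      moreover have "m \<ge> d \<Longrightarrow> Poly_Mapping.lookup v m = 0"
        using that unfolding f2_space_def by (auto simp: in_keys_iff)
      ultimately show "Poly_Mapping.lookup v m = Poly_Mapping.lookup ?s m"
        by (cases "m < d") auto
    qed
    moreover have "?s \<in> f2.span ?E"
      by (intro f2.span_sum f2.span_scale f2.span_base) auto
    ultimately show ?thesis by simp
  qed
  then have "X \<subseteq> f2.span ?E" using assms by blast
  then have "f2.dim X \<le> card ?E" by (rule f2.dim_le_card) simp
  also have "\<dots> \<le> d" using card_image_le[of "{..<d}"] by simp
  finally show ?thesis .
qed

section \<open>The block configuration of a formula\<close>

text \<open>
  The list \<open>vs\<close> fixes the order in which the variables contribute their blocks.
\<close>

locale ksat_configuration =
  fixes k :: nat and \<phi> :: "'v::finite formula" and vs :: "'v list"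
  assumes ksat: "ksat_formula k \<phi>"
    and all_vars: "formula_vars \<phi> = UNIV"
    and distinct_vs: "distinct vs"
    and set_vs: "set vs = UNIV"
begin

definition clause_holds :: "nat \<Rightarrow> ('v \<Rightarrow> bool) \<Rightarrow> bool" where
  "clause_holds i a \<longleftrightarrow> (\<exists>l \<in> set (\<phi> ! i). lit_holds a l)"

text \<open>
  The truth values of the variables are recorded, not those of the literals: this makes the trace
  additive over the set of true variables, whatever the signs of the literals are.
\<close>

definition clause_trace :: "nat \<Rightarrow> ('v \<Rightarrow> bool) \<Rightarrow> f2vec" where
  "clause_trace i a = (\<Sum>j<length (\<phi> ! i).
     if a (lit_var (\<phi> ! i ! j)) then Poly_Mapping.single (k * i + j) 1 else 0)"

definition var_vec :: "'v \<Rightarrow> f2vec" where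
  "var_vec v = (\<Sum>i<length \<phi>. clause_trace i (\<lambda>u. u = v))"

definition config :: block_config where
  "config = map (\<lambda>v. {0, var_vec v}) vs
     @ map (\<lambda>i. clause_trace i ` {a. clause_holds i a}) [0..<length \<phi>]"

definition transversal :: "('v \<Rightarrow> bool) \<Rightarrow> f2vec list" where
  "transversal a = map (\<lambda>v. if a v then var_vec v else 0) vs
     @ map (\<lambda>i. clause_trace i a) [0..<length \<phi>]"

lemma length_vs: "length vs = CARD('v)"
  using distinct_card[OF distinct_vs] set_vs by simp

lemma length_config: "length config = CARD('v) + length \<phi>"
  by (simp add: config_def length_vs)

lemma clauseD:
  assumes "i < length \<phi>"
  shows "1 \<le> length (\<phi> ! i)" "length (\<phi> ! i) \<le> k" "distinct (map lit_var (\<phi> ! i))"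
  using ksat nth_mem[OF assms] unfolding ksat_formula_def by auto

lemma formula_holds_iff: "formula_holds a \<phi> \<longleftrightarrow> (\<forall>i<length \<phi>. clause_holds i a)"
  unfolding formula_holds_def clause_holds_def by (rule all_set_conv_all_nth)

text \<open>
  Since a clause has at most \<open>k\<close> literals, division with remainder by \<open>k\<close> recovers the clause and
  the position from the index. So traces of different clauses have disjoint supports.
\<close>

lemma lookup_clause_trace:
  assumes "i < length \<phi>" "j < length (\<phi> ! i)" "i' < length \<phi>"
  shows "Poly_Mapping.lookup (clause_trace i' a) (k * i + j)
    = of_bool (i' = i \<and> a (lit_var (\<phi> ! i ! j)))"
proof -
  have eq: "k * i' + j' = k * i + j \<longleftrightarrow> i' = i \<and> j' = j" if "j' < length (\<phi> ! i')" for j'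
  proof
    assume *: "k * i' + j' = k * i + j"
    have lt: "j' < k" "j < k"
      using that assms clauseD(2)[of i] clauseD(2)[of i'] by auto
    have "(k * i' + j') div k = i'" "(k * i + j) div k = i"
      using lt by auto
    with * show "i' = i \<and> j' = j" by auto
  qed auto
  have "Poly_Mapping.lookup (clause_trace i' a) (k * i + j) =
    (\<Sum>j'<length (\<phi> ! i'). if j' = j then of_bool (i' = i \<and> a (lit_var (\<phi> ! i ! j))) else 0)"
    unfolding clause_trace_def lookup_sum
  proof (intro sum.cong refl)
    fix j' assume "j' \<in> {..<length (\<phi> ! i')}"
    then have "k * i' + j' = k * i + j \<longleftrightarrow> i' = i \<and> j' = j" using eq by simp
    then show "Poly_Mapping.lookup (if a (lit_var (\<phi> ! i' ! j'))
        then Poly_Mapping.single (k * i' + j') 1 else 0) (k * i + j)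
      = (if j' = j then of_bool (i' = i \<and> a (lit_var (\<phi> ! i ! j))) else 0)"
      by (cases "i' = i"; cases "j' = j") (auto simp: lookup_single when_def)
  qed
  then show ?thesis using assms by auto
qed

lemma clause_trace_eq_iff:
  assumes "i < length \<phi>"
  shows "clause_trace i a = clause_trace i b
    \<longleftrightarrow> (\<forall>l \<in> set (\<phi> ! i). lit_holds a l = lit_holds b l)"
proof -
  have lit: "lit_holds a l = lit_holds b l \<longleftrightarrow> a (lit_var l) = b (lit_var l)" for l
    by (cases l) auto
  show ?thesis
  proof
    assume *: "clause_trace i a = clause_trace i b"
    have "a (lit_var (\<phi> ! i ! j)) = b (lit_var (\<phi> ! i ! j))" if "j < length (\<phi> ! i)" for j
      using lookup_clause_trace[OF assms that assms, of a]
        lookup_clause_trace[OF assms that assms, of b] * by (auto simp: of_bool_def split: if_splits)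
    then show "\<forall>l \<in> set (\<phi> ! i). lit_holds a l = lit_holds b l"
      unfolding lit by (auto simp: in_set_conv_nth)
  next
    assume "\<forall>l \<in> set (\<phi> ! i). lit_holds a l = lit_holds b l"
    then show "clause_trace i a = clause_trace i b"
      unfolding clause_trace_def lit by (intro sum.cong) auto
  qed
qed

lemma clause_trace_in_space:
  assumes "i < length \<phi>"
  shows "clause_trace i a \<in> f2_space (k * length \<phi>)"
proof -
  have "k * i + j < k * length \<phi>" if "j < length (\<phi> ! i)" for j
  proof -
    have "k * i + j < k * Suc i" using that clauseD(2)[OF assms] by simp
    also have "\<dots> \<le> k * length \<phi>" using assms by (intro mult_le_mono2) simp
    finally show ?thesis .
  qed
  then show ?thesis
    unfolding clause_trace_def by (intro f2_space_sum) (auto simp: f2_space_def)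
qed

text \<open>
  This is where the occurrence of every variable enters: the two elements of a variable block are
  different, so that the block really distinguishes the two truth values.
\<close>

lemma var_vec_nonzero: "var_vec v \<noteq> 0"
proof
  assume *: "var_vec v = 0"
  have "v \<in> formula_vars \<phi>" using all_vars by simp
  then obtain C l where "C \<in> set \<phi>" "l \<in> set C" "lit_var l = v"
    unfolding formula_vars_def by blast
  then obtain i j where ij: "i < length \<phi>" "j < length (\<phi> ! i)" "lit_var (\<phi> ! i ! j) = v"
    by (auto simp: in_set_conv_nth)
  have "Poly_Mapping.lookup (var_vec v) (k * i + j) = (\<Sum>i'<length \<phi>. if i' = i then 1 else 0)"
    unfolding var_vec_def lookup_sum
    by (intro sum.cong) (auto simp: lookup_clause_trace[OF ij(1,2)] ij(3))
  then show False using * ij by simp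
qed

text \<open>
  Each position of a clause carries exactly one variable, so a trace is the sum of the traces of the
  single true variables. Exchanging the summation over clauses and variables gives the claim.
\<close>

lemma sum_var_vec:
  "(\<Sum>v\<in>UNIV. if a v then var_vec v else 0) = (\<Sum>i<length \<phi>. clause_trace i a)"
proof -
  have trace: "clause_trace i a = (\<Sum>v\<in>UNIV. if a v then clause_trace i (\<lambda>u. u = v) else 0)" for i
  proof -
    have "(\<Sum>v\<in>UNIV. if a v then clause_trace i (\<lambda>u. u = v) else 0)
      = (\<Sum>v\<in>UNIV. \<Sum>j<length (\<phi> ! i). if lit_var (\<phi> ! i ! j) = v
           then (if a (lit_var (\<phi> ! i ! j)) then Poly_Mapping.single (k * i + j) 1 else 0) else 0)"
      unfolding clause_trace_def by (intro sum.cong) (auto intro!: sum.cong sum.neutral)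
    also have "\<dots> = clause_trace i a"
      unfolding clause_trace_def by (subst sum.swap) simp
    finally show ?thesis by simp
  qed
  have "(\<Sum>v\<in>UNIV. if a v then var_vec v else 0)
    = (\<Sum>v\<in>UNIV. \<Sum>i<length \<phi>. if a v then clause_trace i (\<lambda>u. u = v) else 0)"
    unfolding var_vec_def by (intro sum.cong) auto
  also have "\<dots> = (\<Sum>i<length \<phi>. clause_trace i a)"
    by (subst sum.swap) (simp add: trace[symmetric])
  finally show ?thesis .
qed

text \<open>
  By the disjointness of supports, the coordinates of clause \<open>i\<close> see only the two traces in clause
  \<open>i\<close>, and two elements of the two-element field cancel only if they are equal.
\<close>

lemma sum_traces_eq_0_iff:
  "(\<Sum>i<length \<phi>. clause_trace i a) + (\<Sum>i<length \<phi>. clause_trace i (b i)) = 0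
    \<longleftrightarrow> (\<forall>i<length \<phi>. clause_trace i a = clause_trace i (b i))" (is "?s = 0 \<longleftrightarrow> _")
proof
  assume s: "?s = 0"
  show "\<forall>i<length \<phi>. clause_trace i a = clause_trace i (b i)"
  proof (intro allI impI)
    fix i assume i: "i < length \<phi>"
    have "a (lit_var (\<phi> ! i ! j)) = b i (lit_var (\<phi> ! i ! j))" if j: "j < length (\<phi> ! i)" for j
    proof -
      have *: "Poly_Mapping.lookup (\<Sum>i'<length \<phi>. clause_trace i' (c i')) (k * i + j)
        = of_bool (c i (lit_var (\<phi> ! i ! j)))" for c
      proof -
        have "Poly_Mapping.lookup (\<Sum>i'<length \<phi>. clause_trace i' (c i')) (k * i + j)
          = (\<Sum>i'<length \<phi>. if i' = i then of_bool (c i (lit_var (\<phi> ! i ! j))) else 0)"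
          unfolding lookup_sum by (intro sum.cong) (auto simp: lookup_clause_trace[OF i j])
        then show ?thesis using i by simp
      qed
      have "Poly_Mapping.lookup ?s (k * i + j) = 0" using s by simp
      then show ?thesis
        by (auto simp: lookup_add *[of "\<lambda>_. a"] *[of b] of_bool_def split: if_splits)
    qed
    then show "clause_trace i a = clause_trace i (b i)"
      unfolding clause_trace_def by (intro sum.cong) auto
  qed
next
  assume "\<forall>i<length \<phi>. clause_trace i a = clause_trace i (b i)"
  then show "?s = 0" by (simp add: f2vec_add_self)
qed

lemma sum_nth_eq:
  assumes "length xs = length config"
  shows "(\<Sum>i<length config. xs ! i) = sum_list (xs :: f2vec list)"
  by (simp add: sum_list_sum_nth atLeast0LessThan assms)

lemma sum_list_config:
  "sum_list (map (\<lambda>v. if a v then var_vec v else 0) vs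
     @ map (\<lambda>i. clause_trace i (b i)) [0..<length \<phi>])
   = (\<Sum>i<length \<phi>. clause_trace i a) + (\<Sum>i<length \<phi>. clause_trace i (b i))"
  by (simp add: sum_list_distinct_conv_sum_set[OF distinct_vs] set_vs sum_var_vec
      interv_sum_list_conv_sum_set_nat atLeast0LessThan)

lemma nth_config:
  "i < length vs \<Longrightarrow> config ! i = {0, var_vec (vs ! i)}"
  "i < length \<phi> \<Longrightarrow> config ! (length vs + i) = clause_trace i ` {a. clause_holds i a}"
  by (simp_all add: config_def nth_append)

lemma nth_transversal:
  "i < length vs \<Longrightarrow> transversal a ! i = (if a (vs ! i) then var_vec (vs ! i) else 0)"
  "i < length \<phi> \<Longrightarrow> transversal a ! (length vs + i) = clause_trace i a"
  by (simp_all add: transversal_def nth_append)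

lemma index_cases:
  assumes "i < length config"
  obtains "i < length vs" | i' where "i = length vs + i'" "i' < length \<phi>"
  using assms that(2)[of "i - length vs"] that(1)
  by (cases "i < length vs") (auto simp: config_def)

lemma length_transversal: "length (transversal a) = length config"
  by (simp add: transversal_def config_def)

text \<open>
  Given a cyclic transversal, an assignment \<open>a\<close> is read off from its variable blocks, while
  clause block \<open>i\<close> contributes the trace of some satisfying \<open>b i\<close>. The vanishing sum forces \<open>a\<close> and
  \<open>b i\<close> to agree on the variables of clause \<open>i\<close>, so \<open>a\<close> satisfies every clause, although the \<open>b i\<close>
  were chosen independently of each other.
\<close>

lemma cyclic_transversals_config:
  "cyclic_transversals config = transversal ` {a. formula_holds a \<phi>}"
proof (intro equalityI subsetI)
  fix \<xi> assume "\<xi> \<in> transversal ` {a. formula_holds a \<phi>}"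
  then obtain a where a: "\<xi> = transversal a" "\<forall>i<length \<phi>. clause_holds i a"
    by (auto simp: formula_holds_iff)
  have "\<xi> ! i \<in> config ! i" if "i < length config" for i
    using that by (cases rule: index_cases) (auto simp: a nth_config nth_transversal)
  moreover have "sum_list \<xi> = 0"
    using sum_list_config[of a "\<lambda>_. a"] by (simp add: a transversal_def f2vec_add_self)
  ultimately show "\<xi> \<in> cyclic_transversals config"
    unfolding cyclic_transversals_def by (simp add: sum_nth_eq a length_transversal)
next
  fix \<xi> assume "\<xi> \<in> cyclic_transversals config"
  then have len: "length \<xi> = length config"
    and mem: "\<And>i. i < length config \<Longrightarrow> \<xi> ! i \<in> config ! i" and sum: "sum_list \<xi> = 0"
    unfolding cyclic_transversals_def by (auto simp: sum_nth_eq)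
  define a where "a = (\<lambda>v. \<exists>i<length vs. vs ! i = v \<and> \<xi> ! i \<noteq> 0)"
  have a: "a (vs ! i) \<longleftrightarrow> \<xi> ! i \<noteq> 0" if "i < length vs" for i
    using that distinct_vs unfolding a_def by (auto simp: nth_eq_iff_index_eq)
  have "\<exists>b. clause_holds i b \<and> \<xi> ! (length vs + i) = clause_trace i b" if "i < length \<phi>" for i
    using mem[of "length vs + i"] that unfolding nth_config(2)[OF that]
    by (auto simp: length_config length_vs)
  then obtain b where b: "\<And>i. i < length \<phi> \<Longrightarrow>
      clause_holds i (b i) \<and> \<xi> ! (length vs + i) = clause_trace i (b i)"
    by metis
  have \<xi>: "\<xi> = map (\<lambda>v. if a v then var_vec v else 0) vs
     @ map (\<lambda>i. clause_trace i (b i)) [0..<length \<phi>]" (is "_ = ?r")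
  proof (rule nth_equalityI)
    show "length \<xi> = length ?r" by (simp add: len config_def)
    fix i assume "i < length \<xi>"
    then have "i < length config" by (simp add: len)
    then show "\<xi> ! i = ?r ! i"
    proof (cases rule: index_cases)
      case 1
      then show ?thesis
        using mem[OF \<open>i < length config\<close>] a[OF 1] by (auto simp: nth_append nth_config)
    next
      case (2 i')
      then show ?thesis using b[of i'] by (simp add: nth_append)
    qed
  qed
  have eq: "\<forall>i<length \<phi>. clause_trace i a = clause_trace i (b i)"
    using sum unfolding \<xi> sum_list_config sum_traces_eq_0_iff .
  then have "\<xi> = transversal a"
    unfolding \<xi> transversal_def by simp
  moreover have "clause_holds i a" if "i < length \<phi>" for i
    using b[OF that] eq that clause_trace_eq_iff[OF that, of a "b i"]
    unfolding clause_holds_def by auto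
  ultimately show "\<xi> \<in> transversal ` {a. formula_holds a \<phi>}"
    by (auto simp: formula_holds_iff)
qed

lemma blocks_in_space:
  assumes "X \<in> set config"
  shows "X \<subseteq> f2_space (k * length \<phi>)"
  using assms clause_trace_in_space
  by (auto simp: config_def var_vec_def f2_space_zero intro!: f2_space_sum)

lemma clause_holds_exists:
  assumes "i < length \<phi>"
  shows "\<exists>a. clause_holds i a"
proof -
  obtain l where "l \<in> set (\<phi> ! i)" using clauseD(1)[OF assms] by (cases "\<phi> ! i") auto
  moreover have "\<exists>a. lit_holds a l"
    by (cases l) (auto intro: exI[of _ "\<lambda>_. True"] exI[of _ "\<lambda>_. False"])
  ultimately show ?thesis unfolding clause_holds_def by blast
qed

lemma block_configuration_config:
  "block_configuration (k * length \<phi>) config"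
proof -
  have p: "\<phi> \<noteq> []" using ksat unfolding ksat_formula_def by blast
  have k: "1 \<le> k" using clauseD(1,2)[of 0] p by force
  have "X \<noteq> {}" if "X \<in> set config" for X
    using that by (auto simp: config_def) (metis clause_holds_exists)
  moreover have "2 \<le> CARD('v) + length \<phi>"
    using p zero_less_card_finite[where 'a = 'v] length_greater_0_conv[of \<phi>] by linarith
  moreover have "1 \<le> k * length \<phi>" using p k by (cases \<phi>) auto
  ultimately show ?thesis
    using blocks_in_space unfolding block_configuration_def length_config by auto
qed

lemma config_rank_le: "config_rank config \<le> k * length \<phi>"
  unfolding config_rank_def f2.dim_span
  by (intro f2_dim_le) (use blocks_in_space in force)

text \<open>
  A trace is determined by the set of positions with a true variable. The set of the positions of
  negative literals never arises from a satisfying assignment, because it makes all literals false.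
\<close>

lemma card_clause_block:
  assumes "i < length \<phi>"
  shows "card (clause_trace i ` {a. clause_holds i a}) \<le> 2 ^ k - 1"
proof -
  let ?n = "length (\<phi> ! i)"
  let ?true = "\<lambda>a. {j. j < ?n \<and> a (lit_var (\<phi> ! i ! j))}"
  let ?bad = "{j. j < ?n \<and> \<phi> ! i ! j = Neg (lit_var (\<phi> ! i ! j))}"
  let ?vec = "\<lambda>S. \<Sum>j<?n. if j \<in> S then Poly_Mapping.single (k * i + j) (1 :: bit) else 0"
  have vec: "clause_trace i a = ?vec (?true a)" for a
    unfolding clause_trace_def by (intro sum.cong) auto
  have true: "?true a \<in> Pow {..<?n} - {?bad}" if sat: "clause_holds i a" for a
  proof -
    obtain j where j: "j < ?n" "lit_holds a (\<phi> ! i ! j)"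
      using sat unfolding clause_holds_def by (auto simp: in_set_conv_nth)
    then have "j \<in> ?true a \<longleftrightarrow> j \<notin> ?bad"
      by (cases "\<phi> ! i ! j") auto
    then show ?thesis by blast
  qed
  have "clause_trace i ` {a. clause_holds i a} \<subseteq> ?vec ` (Pow {..<?n} - {?bad})"
  proof (rule image_subsetI)
    fix a assume "a \<in> {a. clause_holds i a}"
    then have "?true a \<in> Pow {..<?n} - {?bad}" by (intro true) simp
    with vec[of a] show "clause_trace i a \<in> ?vec ` (Pow {..<?n} - {?bad})"
      by (rule image_eqI)
  qed
  then have "card (clause_trace i ` {a. clause_holds i a}) \<le> card (Pow {..<?n} - {?bad})"
    by (intro surj_card_le) auto
  also have "\<dots> = 2 ^ ?n - 1"
    by (subst card_Diff_singleton) (auto simp: card_Pow)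
  also have "\<dots> \<le> 2 ^ k - 1"
    using clauseD(2)[OF assms] by (intro diff_le_mono power_increasing) auto
  finally show ?thesis .
qed

lemma config_size_le: "config_size config \<le> 2 * CARD('v) + length \<phi> * (2 ^ k - 1)"
proof -
  have "config_size config = sum_list (map card config)"
    by (simp add: config_size_def sum_list_sum_nth atLeast0LessThan)
  also have "\<dots> = (\<Sum>v\<in>UNIV. card {0, var_vec v})
      + (\<Sum>i<length \<phi>. card (clause_trace i ` {a. clause_holds i a}))"
    by (simp add: config_def o_def sum_list_distinct_conv_sum_set[OF distinct_vs] set_vs
        interv_sum_list_conv_sum_set_nat atLeast0LessThan)
  also have "\<dots> \<le> (\<Sum>v\<in>(UNIV :: 'v set). 2) + (\<Sum>i<length \<phi>. 2 ^ k - 1)"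
    by (intro add_mono sum_mono) (use card_clause_block in \<open>auto simp: card_insert_if\<close>)
  finally show ?thesis by (simp add: mult.commute)
qed

section \<open>The projection\<close>

definition var_index :: "'v \<Rightarrow> nat" where
  "var_index v = (THE i. i < length vs \<and> vs ! i = v)"

lemma var_index: "var_index v < length vs" "vs ! var_index v = v"
proof -
  have "\<exists>!i. i < length vs \<and> vs ! i = v"
    using distinct_vs set_vs by (metis UNIV_I distinct_Ex1)
  from theI'[OF this] show "var_index v < length vs" "vs ! var_index v = v"
    unfolding var_index_def by auto
qed

definition projection :: "((nat \<times> f2vec) \<Rightarrow>\<^sub>0 real) \<Rightarrow> real ^ 'v" where
  "projection x = (\<chi> v. Poly_Mapping.lookup x (var_index v, var_vec v))"

definition point :: "('v \<Rightarrow> bool) \<Rightarrow> real ^ 'v" where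
  "point a = (\<chi> v. of_bool (a v))"

lemma linear_projection: "linear projection"
  using linear_coordinate_projection[of "\<lambda>v. (var_index v, var_vec v)"]
  unfolding projection_def[abs_def] .

lemma coordinate_projection_projection:
  "coordinate_projection (config_coords config) projection"
  unfolding coordinate_projection_def
proof (intro exI[of _ "\<lambda>v. (var_index v, var_vec v)"] conjI)
  show "inj (\<lambda>v. (var_index v, var_vec v))"
    by (rule injI) (metis prod.inject var_index(2))
  show "range (\<lambda>v. (var_index v, var_vec v)) \<subseteq> config_coords config"
  proof (clarsimp simp: config_coords_def, intro conjI)
    fix v
    show "var_index v < length config" using var_index(1)[of v] by (simp add: config_def)
    show "var_vec v \<in> config ! var_index v"
      using nth_config(1)[OF var_index(1)[of v]] by (simp add: var_index(2))
  qed
  show "projection = (\<lambda>x. \<chi> v. Poly_Mapping.lookup x (var_index v, var_vec v))"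
    by (simp add: projection_def[abs_def])
qed

lemma projection_incidence_vector:
  "projection (incidence_vector (transversal a)) = point a"
  using var_index(1) length_vs
  by (auto simp: projection_def point_def vec_eq_iff lookup_incidence_vector length_transversal
      length_config nth_transversal var_index(2) var_vec_nonzero var_vec_nonzero[symmetric]
      trans_less_add1)

lemma CTP_config:
  "CTP config = convex hull ((\<lambda>a. incidence_vector (transversal a)) ` {a. formula_holds a \<phi>})"
  unfolding CTP_def cyclic_transversals_config image_image ..

lemma sat_polytope_eq: "sat_polytope \<phi> = convex hull (point ` {a. formula_holds a \<phi>})"
  unfolding sat_polytope_def true_points_def point_def
  by (rule arg_cong[where f = "(hull) convex"]) auto

lemma projection_image: "projection ` CTP config = sat_polytope \<phi>"
proof -
  let ?A = "{a. formula_holds a \<phi>}" and ?x = "\<lambda>a. incidence_vector (transversal a)"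
  have "projection ` CTP config = convex hull (projection ` ?x ` ?A)"
    unfolding CTP_config by (rule convex_hull_linear_image[OF linear_projection])
  also have "projection ` ?x ` ?A = point ` ?A"
    by (simp add: image_image projection_incidence_vector)
  finally show ?thesis by (simp add: sat_polytope_eq)
qed

lemma extension_via_projection: "extension_via projection (CTP config) (sat_polytope \<phi>)"
proof -
  have "polytope (CTP config)" "polytope (sat_polytope \<phi>)"
    unfolding CTP_config sat_polytope_eq by (auto intro: polytope_convex_hull)
  then show ?thesis
    unfolding extension_via_def
    using projection_image affine_map_linear[OF linear_projection] by simp
qed

section \<open>Clauses of width two\<close>

definition lit_value :: "'v literal \<Rightarrow> real ^ 'v \<Rightarrow> real" where
  "lit_value l y = (case l of Pos v \<Rightarrow> y $ v | Neg v \<Rightarrow> 1 - y $ v)"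

lemma lit_value_point: "lit_value l (point a) = of_bool (lit_holds a l)"
  by (cases l) (auto simp: lit_value_def point_def)

lemma affine_map_coord: "affine_map (\<lambda>y :: real ^ 'v. y $ v)"
  by (intro affine_map_linear linearI) auto

lemma affine_map_lit_value: "affine_map (lit_value l)"
  unfolding lit_value_def[abs_def]
  by (cases l) (auto intro: affine_map_coord affine_map_diff affine_map_const)

text \<open>
  In terms of the literal values \<open>l\<close> and \<open>m\<close>, which are not both \<open>0\<close> on satisfying assignments, the
  three patterns of a clause have the indicators \<open>l + m - 1\<close>, \<open>1 - m\<close> and \<open>1 - l\<close>. A clause with a
  single literal has only one satisfying pattern. For three literals the seven satisfying
  patterns are affinely dependent, so the argument is confined to width two.
\<close>

lemma affine_clause_indicator:
  assumes i: "i < length \<phi>" and len: "length (\<phi> ! i) \<le> 2" and b: "clause_holds i b"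
  shows "\<exists>h :: real ^ 'v \<Rightarrow> real. affine_map h \<and> (\<forall>a. clause_holds i a \<longrightarrow>
    h (point a) = of_bool (clause_trace i a = clause_trace i b))"
proof -
  have "length (\<phi> ! i) = 1 \<or> length (\<phi> ! i) = 2"
    using clauseD(1)[OF i] len by linarith
  then consider l where "\<phi> ! i = [l]" | l m where "\<phi> ! i = [l, m]"
    by (auto simp: length_Suc_conv numeral_2_eq_2)
  then show ?thesis
  proof cases
    case 1
    then have "\<forall>a. clause_holds i a \<longrightarrow> clause_trace i a = clause_trace i b"
      using b by (auto simp: clause_trace_eq_iff[OF i] clause_holds_def)
    then show ?thesis
      by (intro exI[of _ "\<lambda>_. 1"]) (auto intro: affine_map_const)
  next
    case (2 l m)
    consider "lit_holds b l" "lit_holds b m" | "lit_holds b l" "\<not> lit_holds b m"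
      | "\<not> lit_holds b l" "lit_holds b m"
      using b 2 by (auto simp: clause_holds_def)
    then show ?thesis
    proof cases
      case 1
      then show ?thesis using 2
        by (intro exI[of _ "\<lambda>y. lit_value l y + lit_value m y - 1"])
          (auto simp: clause_holds_def clause_trace_eq_iff[OF i] lit_value_point
            intro!: affine_map_add affine_map_diff affine_map_const affine_map_lit_value)
    next
      case 2
      then show ?thesis using \<open>\<phi> ! i = [l, m]\<close>
        by (intro exI[of _ "\<lambda>y. 1 - lit_value m y"])
          (auto simp: clause_holds_def clause_trace_eq_iff[OF i] lit_value_point
            intro!: affine_map_diff affine_map_const affine_map_lit_value)
    next
      case 3
      then show ?thesis using \<open>\<phi> ! i = [l, m]\<close>
        by (intro exI[of _ "\<lambda>y. 1 - lit_value l y"])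
          (auto simp: clause_holds_def clause_trace_eq_iff[OF i] lit_value_point
            intro!: affine_map_diff affine_map_const affine_map_lit_value)
    qed
  qed
qed

lemma affine_coordinate:
  assumes "k = 2" and c: "(i, \<omega>) \<in> config_coords config"
  shows "\<exists>h. affine_map h \<and> (\<forall>a. formula_holds a \<phi> \<longrightarrow>
    h (point a) = Poly_Mapping.lookup (incidence_vector (transversal a)) (i, \<omega>))"
proof -
  have i: "i < length config" and \<omega>: "\<omega> \<in> config ! i"
    using c by (auto simp: config_coords_def)
  have lookup: "Poly_Mapping.lookup (incidence_vector (transversal a)) (i, \<omega>)
    = of_bool (transversal a ! i = \<omega>)" for a
    using i by (simp add: lookup_incidence_vector length_transversal)
  from i show ?thesis
  proof (cases rule: index_cases)
    case 1
    consider "\<omega> = 0" | "\<omega> = var_vec (vs ! i)" using \<omega> nth_config(1)[OF 1] by auto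
    then show ?thesis
    proof cases
      case zero: 1
      show ?thesis unfolding lookup
        by (intro exI[of _ "\<lambda>y. 1 - y $ (vs ! i)"] conjI)
          (auto simp: zero nth_transversal(1)[OF 1] var_vec_nonzero point_def
            intro!: affine_map_diff affine_map_const affine_map_coord)
    next
      case vec: 2
      show ?thesis unfolding lookup
        by (intro exI[of _ "\<lambda>y. y $ (vs ! i)"] conjI)
          (auto simp: vec nth_transversal(1)[OF 1] var_vec_nonzero var_vec_nonzero[symmetric]
            point_def intro!: affine_map_coord)
    qed
  next
    case (2 i')
    then obtain b where b: "clause_holds i' b" "\<omega> = clause_trace i' b"
      using \<omega> nth_config(2) by auto
    have "length (\<phi> ! i') \<le> 2" using clauseD(2)[OF 2(2)] assms(1) by simp
    then obtain h :: "real ^ 'v \<Rightarrow> real" where h: "affine_map h"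
      "\<And>a. clause_holds i' a \<Longrightarrow> h (point a) = of_bool (clause_trace i' a = \<omega>)"
      using affine_clause_indicator[OF 2(2) _ b(1)] b(2) by blast
    have "h (point a) = of_bool (transversal a ! i = \<omega>)" if "formula_holds a \<phi>" for a
      using that h(2) 2(2) unfolding 2(1) nth_transversal(2)[OF 2(2)] formula_holds_iff by blast
    then show ?thesis unfolding lookup using h(1) by blast
  qed
qed

lemma finite_config_coords: "finite (config_coords config)"
proof -
  have "finite (config ! i)" if "i < length config" for i
    using that
  proof (cases rule: index_cases)
    case 1
    then show ?thesis by (simp add: nth_config)
  next
    case (2 i')
    then show ?thesis by (simp add: nth_config)
  qed
  moreover have "config_coords config = Sigma {..<length config} (\<lambda>i. config ! i)"
    by (auto simp: config_coords_def)
  ultimately show ?thesis by (auto intro!: finite_SigmaI)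
qed

lemma lookup_transversal_outside:
  assumes "formula_holds a \<phi>" "c \<notin> config_coords config"
  shows "Poly_Mapping.lookup (incidence_vector (transversal a)) c = 0"
proof -
  have "transversal a \<in> cyclic_transversals config"
    using assms(1) unfolding cyclic_transversals_config by blast
  then show ?thesis
    using assms(2) by (cases c) (auto simp: cyclic_transversals_def config_coords_def
      lookup_incidence_vector)
qed

text \<open>
  The affine functions for the single coordinates are assembled into one map into the space of
  finitely supported functions; coordinates outside the index set are zero on both sides.
\<close>

lemma affine_left_inverse:
  assumes "k = 2"
  shows "\<exists>g. affine_map g \<and>
    (\<forall>a. formula_holds a \<phi> \<longrightarrow> g (point a) = incidence_vector (transversal a))"
proof -
  have "\<forall>c\<in>config_coords config. \<exists>h. affine_map h \<and> (\<forall>a. formula_holds a \<phi> \<longrightarrow>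
      h (point a) = Poly_Mapping.lookup (incidence_vector (transversal a)) c)"
    using affine_coordinate[OF assms] by (metis surj_pair)
  then obtain h where h: "\<And>c. c \<in> config_coords config \<Longrightarrow> affine_map (h c)"
    "\<And>c a. c \<in> config_coords config \<Longrightarrow> formula_holds a \<phi> \<Longrightarrow>
      h c (point a) = Poly_Mapping.lookup (incidence_vector (transversal a)) c"
    by metis
  have lin: "linear (\<lambda>r. Poly_Mapping.single c (r :: real))" for c :: "nat \<times> f2vec"
    by (rule linearI; rule poly_mapping_eqI)
      (simp_all add: lookup_add lookup_scaleR lookup_single when_def)
  define g where "g y = (\<Sum>c\<in>config_coords config. Poly_Mapping.single c (h c y))" for y
  have "affine_map g"
    unfolding g_def[abs_def] by (intro affine_map_sum affine_map_compose_linear[OF lin] h(1))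
  moreover have "g (point a) = incidence_vector (transversal a)" if a: "formula_holds a \<phi>" for a
  proof (rule poly_mapping_eqI)
    fix c
    have "Poly_Mapping.lookup (g (point a)) c
      = (\<Sum>c'\<in>config_coords config. if c' = c then h c (point a) else 0)"
      unfolding g_def lookup_sum by (intro sum.cong) (auto simp: lookup_single when_def)
    also have "\<dots> = Poly_Mapping.lookup (incidence_vector (transversal a)) c"
      using finite_config_coords h(2)[OF _ a] lookup_transversal_outside[OF a] by auto
    finally show "Poly_Mapping.lookup (g (point a)) c
      = Poly_Mapping.lookup (incidence_vector (transversal a)) c" .
  qed
  ultimately show ?thesis by blast
qed

lemma affine_isomorphism_projection:
  assumes "k = 2"
  shows "affine_isomorphism projection (CTP config) (sat_polytope \<phi>)"
proof -
  obtain g where g: "affine_map g"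
    and inv: "\<And>a. formula_holds a \<phi> \<Longrightarrow> g (point a) = incidence_vector (transversal a)"
    using affine_left_inverse[OF assms] by blast
  have aff: "affine_map projection" by (rule affine_map_linear[OF linear_projection])
  have left: "g (projection x) = x" if "x \<in> CTP config" for x
    using that unfolding CTP_config
    by (rule left_inverse_on_convex_hull[OF aff g, rotated])
      (auto simp: projection_incidence_vector inv)
  then have "bij_betw projection (CTP config) (sat_polytope \<phi>)"
    unfolding bij_betw_def projection_image[symmetric] by (metis inj_on_inverseI)
  then show ?thesis
    unfolding affine_isomorphism_def using aff g left by blast
qed

end

theorem theorem3p2:
  fixes k :: nat and \<phi> :: "'v::finite formula"
  assumes "k \<ge> 2"
    and "ksat_formula k \<phi>"
    and "formula_vars \<phi> = UNIV"
  shows "\<exists>d \<B> (\<pi> :: ((nat \<times> f2vec) \<Rightarrow>\<^sub>0 real) \<Rightarrow> real ^ 'v).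
    block_configuration d \<B> \<and>
    length \<B> = CARD('v) + length \<phi> \<and>
    config_size \<B> \<le> 2 * CARD('v) + length \<phi> * (2 ^ k - 1) \<and>
    config_rank \<B> \<le> k * length \<phi> \<and>
    coordinate_projection (config_coords \<B>) \<pi> \<and>
    extension_via \<pi> (CTP \<B>) (sat_polytope \<phi>) \<and>
    (k = 2 \<longrightarrow> affine_isomorphism \<pi> (CTP \<B>) (sat_polytope \<phi>))"
proof -
  obtain vs :: "'v list" where "distinct vs" "set vs = UNIV"
    using finite_distinct_list[of "UNIV :: 'v set"] by auto
  then interpret ksat_configuration k \<phi> vs
    using assms by unfold_locales
  show ?thesis
    using block_configuration_config length_config config_size_le config_rank_le
      coordinate_projection_projection extension_via_projection affine_isomorphism_projection
    by blast
qed

end
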